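(* Let $G$ be a finite simple graph. If $\operatorname{imb}_G(e)>0$ for every edge $e\in E(G)$, then the imbalance multiset $M_G$ of $G$ is graphic, i.e. there exists a finite simple graph $H$ whose multiset of vertex degrees equals $M_G$.
   Context: All graphs are finite, simple, and undirected. For a vertex $v$ of a graph $G$, $d_G(v)$ denotes its degree. The imbalance of an edge $uv\in E(G)$ is $\operatorname{imb}_G(uv)=|d_G(u)-d_G(v)|$. The imbalance multiset $M_G$ is the multiset of the values $\operatorname{imb}_G(e)$, one for each $e\in E(G)$ (counted with multiplicity). A finite multiset of nonnegative integers is called graphic if it is the multiset of vertex degrees (counted with multiplicity) of a finite simple graph. The graph with no vertices is allowed as a finite simple graph, so the empty multiset is graphic. *)

theory Defs
  imports Main "HOL-Library.Multiset"
begin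

text \<open>
  A graph is given by its vertex set and its edge set; an edge is the two-element set of its
  end vertices, so that there are no loops and no parallel edges.
\<close>

definition fin_simple_graph :: "'a set \<Rightarrow> 'a set set \<Rightarrow> bool" where
  "fin_simple_graph V E \<longleftrightarrow> finite V \<and> (\<forall>e\<in>E. e \<subseteq> V \<and> card e = 2)"

definition degree :: "'a set set \<Rightarrow> 'a \<Rightarrow> nat" where
  "degree E v = card {e \<in> E. v \<in> e}"

text \<open>
  The imbalance is a function of the unordered pair; the description is well defined because
  the absolute difference is symmetric, see \<open>imb_insert\<close> below.
\<close>

definition imb :: "'a set set \<Rightarrow> 'a set \<Rightarrow> nat" where
  "imb E e = (THE k. \<exists>u v. e = {u, v} \<and> k = nat \<bar>int (degree E u) - int (degree E v)\<bar>)"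

lemma imb_insert: "imb E {u, v} = nat \<bar>int (degree E u) - int (degree E v)\<bar>"
  unfolding imb_def
  by (rule the_equality) (auto simp: doubleton_eq_iff abs_minus_commute)

definition imbalance_mset :: "'a set set \<Rightarrow> nat multiset" where
  "imbalance_mset E = image_mset (imb E) (mset_set E)"

definition degree_mset :: "'a set \<Rightarrow> 'a set set \<Rightarrow> nat multiset" where
  "degree_mset V E = image_mset (degree E) (mset_set V)"

text \<open>
  Taking the vertices to be natural numbers is no restriction, as the graphs are finite.
\<close>

definition graphic :: "nat multiset \<Rightarrow> bool" where
  "graphic M \<longleftrightarrow> (\<exists>(V :: nat set) E. fin_simple_graph V E \<and> degree_mset V E = M)"

lemma fin_simple_graph_finite_edges: "fin_simple_graph V E \<Longrightarrow> finite E"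
  unfolding fin_simple_graph_def by (meson PowI finite_Pow_iff finite_subset subsetI)

end

theory Submission
  imports Defs Complex_Main
begin

text \<open>
  By the criterion of Erdos and Gallai, a family of naturals \<open>(d i)\<close> indexed by a finite set \<open>I\<close>
  is the degree family of a simple graph on \<open>I\<close> if its sum is even and
  \<open>(\<Sum>i\<in>F. d i) \<le> k * (k - 1) + (\<Sum>i\<in>I - F. min k (d i))\<close> with \<open>k = card F\<close>
  for all \<open>F \<subseteq> I\<close>; it suffices to have this when all entries on \<open>F\<close> are at least \<open>k\<close>. The criterion
  is \<open>erdos_gallai\<close> below, and it is applied to the family of imbalances, indexed by the edges of
  the given graph. Their sum is even because it is congruent to the sum of the squares of the
  degrees (\<open>even_sum_imb\<close>). The inequality (\<open>imbalance_erdos_gallai_ineq\<close>) is the heart of the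
  matter.

  Let \<open>F\<close> be a set of \<open>k\<close> edges of imbalance at least \<open>k\<close>. Let \<open>g u\<close> be the number of edges of \<open>F\<close>
  that have \<open>u\<close> as their end of larger degree, and \<open>U\<close> the set of \<open>u\<close> with \<open>g u > 0\<close>; then \<open>g\<close> sums
  to \<open>k\<close>, and vertices of \<open>U\<close> have degree at least \<open>k + 1\<close>. The larger degrees of the edges in
  \<open>F\<close> add up to \<open>\<Sum>u. g u * degree u\<close>, which is the same as charging \<open>g u + g v\<close> to every
  edge \<open>{u, v}\<close> of the graph. So the inequality compares this charge with \<open>min k (imb e)\<close> edge by
  edge. The edges of \<open>F\<close> receive \<open>\<Sum>u. g u * g u\<close> from their ends of larger degree, so that
  \<open>S = \<Sum>u. g u * (k - g u)\<close> is left of \<open>k\<^sup>2\<close>. What they receive from their other ends, and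
  the difference of \<open>k\<^sup>2\<close> and \<open>k * (k - 1)\<close>, is covered by the smaller degrees, which are
  subtracted in the imbalances. So the edges outside \<open>F\<close> may overdraw \<open>min k (imb e)\<close> by \<open>S\<close>.

  Edges inside \<open>U\<close> overdraw by at most \<open>g u * g v\<close>, so by at most \<open>S / 2\<close> altogether. An edge
  \<open>{x, y}\<close> with only \<open>x\<close> in \<open>U\<close> overdraws \<open>g x - imb\<close>, and this is positive only if the degree of
  \<open>y\<close> is close to that of \<open>x\<close>. Then \<open>y\<close> has large degree itself, so it lies on many edges that do
  not meet \<open>U\<close>; each of these is charged nothing and has imbalance at least 1, and so gives back 1.
  An edge between two such vertices \<open>y\<close> has to be shared between them. The remaining half of \<open>S\<close>
  makes up for that, which is the content of \<open>near_neighbour_excess_bound\<close>.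
\<close>

section \<open>Neighbourhoods and double counting\<close>

definition nbhd :: "'a set set \<Rightarrow> 'a \<Rightarrow> 'a set" where
  "nbhd E v = {w. {v, w} \<in> E}"

lemma mem_nbhd_sym: "w \<in> nbhd E v \<longleftrightarrow> v \<in> nbhd E w"
  by (simp add: nbhd_def insert_commute)

lemma
  assumes "fin_simple_graph V E"
  shows nbhd_subset: "nbhd E v \<subseteq> V" and finite_nbhd: "finite (nbhd E v)"
    and not_in_own_nbhd: "v \<notin> nbhd E v"
proof -
  show 1: "nbhd E v \<subseteq> V" using assms by (auto simp: nbhd_def fin_simple_graph_def)
  show "finite (nbhd E v)" using 1 assms finite_subset by (auto simp: fin_simple_graph_def)
  show "v \<notin> nbhd E v" using assms by (force simp: nbhd_def fin_simple_graph_def)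
qed

lemma edge_cases:
  assumes "fin_simple_graph V E" "e \<in> E"
  obtains u v where "e = {u, v}" "u \<noteq> v" "u \<in> V" "v \<in> V"
  using assms unfolding fin_simple_graph_def
  by (metis card_2_iff insert_subset)

lemma bij_betw_nbhd:
  assumes "fin_simple_graph V E"
  shows "bij_betw (\<lambda>w. {v, w}) (nbhd E v) {e \<in> E. v \<in> e}"
  unfolding bij_betw_def
proof
  show "inj_on (\<lambda>w. {v, w}) (nbhd E v)" by (auto simp: inj_on_def doubleton_eq_iff)
  show "(\<lambda>w. {v, w}) ` nbhd E v = {e \<in> E. v \<in> e}"
  proof
    show "{e \<in> E. v \<in> e} \<subseteq> (\<lambda>w. {v, w}) ` nbhd E v"
    proof
      fix e assume e: "e \<in> {e \<in> E. v \<in> e}"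
      then obtain a b where "e = {a, b}" using edge_cases[OF assms, of e] by blast
      then show "e \<in> (\<lambda>w. {v, w}) ` nbhd E v"
        using e by (auto simp: nbhd_def insert_commute)
    qed
  qed (auto simp: nbhd_def)
qed

lemma degree_eq_card_nbhd:
  assumes "fin_simple_graph V E"
  shows "degree E v = card (nbhd E v)"
  unfolding degree_def using bij_betw_same_card[OF bij_betw_nbhd[OF assms]] by metis

lemma degree_insert:
  assumes "finite E" "e \<notin> E"
  shows "degree (insert e E) v = degree E v + of_bool (v \<in> e)"
proof -
  have "{e' \<in> insert e E. v \<in> e'} = (if v \<in> e then insert e {e' \<in> E. v \<in> e'} else {e' \<in> E. v \<in> e'})"
    by auto
  then show ?thesis using assms by (simp add: degree_def)
qed

lemma degree_remove:
  assumes "finite E" "e \<in> E"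
  shows "degree E v = degree (E - {e}) v + of_bool (v \<in> e)"
  using degree_insert[of "E - {e}" e v] assms by (simp add: insert_absorb)

lemma sum_swap_nbhd:
  fixes f :: "'a \<Rightarrow> 'a \<Rightarrow> 'b::comm_monoid_add"
  assumes "finite A" "finite B"
  shows "(\<Sum>v\<in>A. \<Sum>w\<in>nbhd E v \<inter> B. f v w) = (\<Sum>w\<in>B. \<Sum>v\<in>nbhd E w \<inter> A. f v w)"
proof -
  have "(\<Sum>v\<in>A. \<Sum>w\<in>nbhd E v \<inter> B. f v w) = (\<Sum>v\<in>A. \<Sum>w | w \<in> B \<and> w \<in> nbhd E v. f v w)"
    by (intro sum.cong) auto
  also have "\<dots> = (\<Sum>w\<in>B. \<Sum>v | v \<in> A \<and> w \<in> nbhd E v. f v w)"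
    using assms by (rule sum.swap_restrict)
  also have "\<dots> = (\<Sum>w\<in>B. \<Sum>v\<in>nbhd E w \<inter> A. f v w)"
    by (intro sum.cong) (auto simp: mem_nbhd_sym)
  finally show ?thesis .
qed

lemma sum_incidence:
  fixes f :: "'a \<Rightarrow> 'a set \<Rightarrow> 'b::comm_monoid_add"
  assumes "fin_simple_graph V E"
  shows "(\<Sum>v\<in>V. \<Sum>w\<in>nbhd E v. f v {v, w}) = (\<Sum>e\<in>E. \<Sum>v\<in>e. f v e)"
proof -
  have V: "finite V" "\<And>e. e \<in> E \<Longrightarrow> e \<subseteq> V" using assms by (auto simp: fin_simple_graph_def)
  have "(\<Sum>v\<in>V. \<Sum>w\<in>nbhd E v. f v {v, w}) = (\<Sum>v\<in>V. \<Sum>e | e \<in> E \<and> v \<in> e. f v e)"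
    using sum.reindex_bij_betw[OF bij_betw_nbhd[OF assms]] by (intro sum.cong) auto
  also have "\<dots> = (\<Sum>e\<in>E. \<Sum>v | v \<in> V \<and> v \<in> e. f v e)"
    using V(1) fin_simple_graph_finite_edges[OF assms] by (rule sum.swap_restrict)
  also have "\<dots> = (\<Sum>e\<in>E. \<Sum>v\<in>e. f v e)"
    using V(2) by (intro sum.cong) auto
  finally show ?thesis .
qed

lemma sum_arcs:
  fixes f :: "'a set \<Rightarrow> real"
  assumes "fin_simple_graph V E"
  shows "(\<Sum>v\<in>V. \<Sum>w\<in>nbhd E v. f {v, w}) = 2 * (\<Sum>e\<in>E. f e)"
proof -
  have "(\<Sum>v\<in>V. \<Sum>w\<in>nbhd E v. f {v, w}) = (\<Sum>e\<in>E. \<Sum>v\<in>e. f e)"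
    using sum_incidence[OF assms, of "\<lambda>v e. f e"] by simp
  also have "\<dots> = (\<Sum>e\<in>E. 2 * f e)"
    using assms by (intro sum.cong) (auto simp: fin_simple_graph_def)
  finally show ?thesis by (simp add: sum_distrib_left)
qed

section \<open>The Erdos-Gallai criterion\<close>

definition erdos_gallai_ineq :: "'i set \<Rightarrow> ('i \<Rightarrow> nat) \<Rightarrow> 'i set \<Rightarrow> bool" where
  "erdos_gallai_ineq I d F \<longleftrightarrow> sum d F \<le> card F * (card F - 1) + (\<Sum>i\<in>I - F. min (card F) (d i))"

text \<open>
  Removing from \<open>F\<close> an element \<open>j\<close> with \<open>d j < card F = k\<close> lowers the left side by \<open>d j\<close> and the right
  side by at least \<open>2 * (k - 1) - d j\<close>, which is no less. So the inequality for \<open>F - {j}\<close> implies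
  that for \<open>F\<close>.
\<close>

lemma erdos_gallai_ineq_if_large:
  assumes fin: "finite I"
    and large: "\<And>F. F \<subseteq> I \<Longrightarrow> (\<forall>i\<in>F. card F \<le> d i) \<Longrightarrow> erdos_gallai_ineq I d F"
    and "F \<subseteq> I"
  shows "erdos_gallai_ineq I d F"
  using \<open>F \<subseteq> I\<close>
proof (induction "card F" arbitrary: F)
  case 0
  then have "F = {}" using fin finite_subset by fastforce
  then show ?case by (simp add: erdos_gallai_ineq_def)
next
  case (Suc k)
  have finF: "finite F" using Suc.prems fin finite_subset by blast
  show ?case
  proof (cases "\<forall>i\<in>F. card F \<le> d i")
    case True
    then show ?thesis using large Suc.prems by blast
  next
    case False
    then obtain j where j: "j \<in> F" "d j \<le> k" using Suc.hyps(2) by fastforce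
    have cF: "card (F - {j}) = k" using j finF Suc.hyps(2) by simp
    have IF: "I - (F - {j}) = insert j (I - F)" using j Suc.prems by auto
    have "erdos_gallai_ineq I d (F - {j})" using Suc.hyps(1)[of "F - {j}"] cF Suc.prems by auto
    then have 1: "sum d (F - {j}) \<le> k * (k - 1) + (d j + (\<Sum>i\<in>I - F. min k (d i)))"
      unfolding erdos_gallai_ineq_def cF IF using fin j by simp
    have 2: "sum d F = d j + sum d (F - {j})" using finF j by (simp add: sum.remove)
    have 3: "(\<Sum>i\<in>I - F. min k (d i)) \<le> (\<Sum>i\<in>I - F. min (Suc k) (d i))"
      by (intro sum_mono) auto
    have 4: "k * (k - 1) + 2 * k = Suc k * k" by (cases k) auto
    show ?thesis unfolding erdos_gallai_ineq_def Suc.hyps(2)[symmetric] using 1 2 3 4 j by simp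
  qed
qed

text \<open>
  This is the reduction step of Choudum's proof of the criterion. Only a set \<open>F\<close> that avoids both
  \<open>p\<close> and \<open>n\<close> is critical, as its left side stays the same. If then \<open>d p > card F\<close>, the right side
  drops by at most 1, through \<open>n\<close>, and the old inequality is strict: otherwise the entry \<open>d p\<close>, being
  at least the average over \<open>F\<close>, would violate the inequality for \<open>insert p F\<close>. If
  \<open>d p \<le> card F\<close>, all entries on \<open>F\<close> equal \<open>card F\<close>, and the parity of the sum excludes the only
  bad case.
\<close>

lemma erdos_gallai_ineq_decrement:
  assumes fin: "finite I" and ev: "even (sum d I)"
    and EG: "\<And>F. F \<subseteq> I \<Longrightarrow> erdos_gallai_ineq I d F"
    and p: "p \<in> I" and n: "n \<in> I" and pn: "p \<noteq> n"
    and mx: "\<And>i. i \<in> I \<Longrightarrow> d i \<le> d p" and pos: "0 < d n"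
    and F: "F \<subseteq> I"
  shows "erdos_gallai_ineq I (d(p := d p - 1, n := d n - 1)) F"
proof (rule erdos_gallai_ineq_if_large[OF fin _ F])
  fix F assume F: "F \<subseteq> I"
  let ?d = "d(p := d p - 1, n := d n - 1)"
  let ?k = "card F"
  assume large: "\<forall>i\<in>F. ?k \<le> ?d i"
  have finF: "finite F" using F fin finite_subset by blast
  have dp: "0 < d p" using mx[OF n] pos by linarith
  note E = EG[OF F, unfolded erdos_gallai_ineq_def]
  have ltF: "sum ?d F < sum d F" if "p \<in> F \<or> n \<in> F"
    using that finF dp pos pn by (intro sum_strict_mono_strong[of F "if p \<in> F then p else n"]) auto
  consider (F0) "F = {}" | (pF) "F \<noteq> {}" "p \<in> F" | (nF) "n \<in> F" "p \<notin> F"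
    | (big) "F \<noteq> {}" "p \<notin> F" "n \<notin> F" "?k < d p" | (small) "F \<noteq> {}" "p \<notin> F" "n \<notin> F" "d p \<le> ?k"
    by linarith
  then show "erdos_gallai_ineq I ?d F"
  proof cases
    case F0
    then show ?thesis by (simp add: erdos_gallai_ineq_def)
  next
    case pF
    have "(\<Sum>i\<in>I - F. min ?k (d i)) \<le> (\<Sum>i\<in>I - F. min ?k (?d i)) + 1"
    proof (cases "n \<in> F")
      case True
      then have "(\<Sum>i\<in>I - F. min ?k (d i)) = (\<Sum>i\<in>I - F. min ?k (?d i))"
        using pF by (intro sum.cong) auto
      then show ?thesis by simp
    next
      case False
      then have n': "n \<in> I - F" using n by simp
      have "(\<Sum>i\<in>I - F - {n}. min ?k (d i)) = (\<Sum>i\<in>I - F - {n}. min ?k (?d i))"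
        using pF by (intro sum.cong) auto
      moreover have "min ?k (d n) \<le> min ?k (?d n) + 1" by simp
      ultimately show ?thesis using fin n' by (simp add: sum.remove[of "I - F" n])
    qed
    then show ?thesis using E ltF pF unfolding erdos_gallai_ineq_def by simp
  next
    case nF
    have "?k \<le> d n - 1" using large nF pn by force
    then have "?k \<le> d p - 1" using mx[OF n] pos by linarith
    then have "(\<Sum>i\<in>I - F. min ?k (d i)) = (\<Sum>i\<in>I - F. min ?k (?d i))"
      using nF by (intro sum.cong) auto
    then show ?thesis using E ltF nF unfolding erdos_gallai_ineq_def by simp
  next
    case big
    define Z where "Z = I - F - {p}"
    have IFp: "I - F = insert p Z" "p \<notin> Z" "n \<in> Z" "finite Z"
      using big p n pn fin unfolding Z_def by auto
    have sameF: "sum ?d F = sum d F" using big by (intro sum.cong) auto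
    have minp: "min ?k (?d p) = ?k" using big pn by auto
    show ?thesis
    proof (rule ccontr)
      assume "\<not> erdos_gallai_ineq I ?d F"
      then have viol: "?k * (?k - 1) + (?k + (\<Sum>i\<in>Z. min ?k (?d i))) < sum d F"
        unfolding erdos_gallai_ineq_def sameF IFp(1) using IFp(2-4) minp by simp
      define S where "S = (\<Sum>i\<in>Z. min ?k (d i))"
      define T where "T = (\<Sum>i\<in>Z. min (Suc ?k) (d i))"
      have E': "sum d F \<le> ?k * (?k - 1) + (?k + S)"
        using E unfolding IFp(1) S_def using IFp(2-4) big by (simp add: min_def)
      have rest: "(\<Sum>i\<in>Z - {n}. min ?k (d i)) = (\<Sum>i\<in>Z - {n}. min ?k (?d i))"
        using IFp by (intro sum.cong) auto
      have rem: "S = min ?k (d n) + (\<Sum>i\<in>Z - {n}. min ?k (d i))"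
        "(\<Sum>i\<in>Z. min ?k (?d i)) = min ?k (d n - 1) + (\<Sum>i\<in>Z - {n}. min ?k (?d i))"
        unfolding S_def using IFp pn by (simp_all add: sum.remove[of Z n])
      have "min ?k (d n - 1) < min ?k (d n)" using viol E' rem rest by linarith
      then have nk: "d n \<le> ?k" by linarith
      \<comment> \<open>The old inequality is an equality, because \<open>n\<close> changes the right side by 1 only.\<close>
      have kk: "?k * (?k - 1) + ?k = ?k * ?k" by (cases ?k) auto
      have eq: "sum d F = ?k * ?k + S" using viol E' rem rest nk pos kk by linarith
      have "erdos_gallai_ineq I d (insert p F)" using EG F p by auto
      moreover have "I - insert p F = Z" unfolding Z_def by auto
      ultimately have E2: "d p + sum d F \<le> Suc ?k * ?k + T"
        unfolding erdos_gallai_ineq_def T_def using finF big by simp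
      have "sum d F \<le> (\<Sum>i\<in>F. d p)" using mx F by (intro sum_mono) auto
      then have avg: "?k * ?k + S \<le> ?k * d p" using eq by simp
      \<comment> \<open>Strict because of the summand \<open>n\<close>, where \<open>0 < d n \<le> ?k\<close>.\<close>
      have "?k * T < Suc ?k * S"
        unfolding S_def T_def sum_distrib_left
      proof (rule sum_strict_mono_strong[of _ n])
        show "?k * min (Suc ?k) (d n) < Suc ?k * min ?k (d n)"
          using nk pos by (simp add: min_def)
        show "?k * min (Suc ?k) (d i) \<le> Suc ?k * min ?k (d i)" for i
          by (cases "d i \<le> ?k") (auto simp: min_def)
      qed (use IFp in auto)
      moreover have "?k * (d p + S) \<le> ?k * (?k + T)"
        using E2 eq by (intro mult_le_mono) auto
      ultimately show False using avg by (simp add: algebra_simps)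
    qed
  next
    case small
    have k: "0 < ?k" using small finF by (simp add: card_gt_0_iff)
    have dk: "d i = ?k" if "i \<in> F" for i
      using large that small F mx[of i] by (metis fun_upd_other le_antisym le_trans subsetD)
    have dpk: "d p = ?k" using small dk mx F by (metis all_not_in_conv le_antisym subsetD)
    have "sum ?d F = (\<Sum>i\<in>F. ?k)" using small dk by (intro sum.cong) auto
    then have sF: "sum ?d F = ?k * ?k" by simp
    define Z where "Z = I - F - {p, n}"
    have IFp: "I - F = insert p (insert n Z)" "p \<notin> Z" "n \<notin> Z" "finite Z"
      using small p n pn fin unfolding Z_def by auto
    \<comment> \<open>Otherwise \<open>d\<close> takes the value \<open>?k\<close> on \<open>?k + 1\<close> elements, 1 at \<open>n\<close> and 0 elsewhere.\<close>
    have "1 \<le> min ?k (d n - 1) + (\<Sum>i\<in>Z. min ?k (d i))"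
    proof (rule ccontr)
      assume "\<not> ?thesis"
      then have "min ?k (d n - 1) = 0" and "(\<Sum>i\<in>Z. min ?k (d i)) = 0" by linarith+
      then have dn: "d n = 1" and "sum d Z = 0"
        using k pos IFp(4) by (auto simp: min_def split: if_splits)
      moreover have "I = F \<union> (I - F)" using F by auto
      then have "sum d I = sum d F + sum d (I - F)"
        using finF fin by (metis F add.commute sum.subset_diff)
      moreover have "sum d (I - F) = ?k + (1 + sum d Z)"
        unfolding IFp(1) using IFp(2-4) pn dn dpk by simp
      moreover have "sum d F = ?k * ?k" using dk by simp
      ultimately have "sum d I = ?k * ?k + ?k + 1" by simp
      then show False using ev by simp
    qed
    moreover have "(\<Sum>i\<in>Z. min ?k (?d i)) = (\<Sum>i\<in>Z. min ?k (d i))"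
      using IFp by (intro sum.cong) auto
    moreover have "(\<Sum>i\<in>insert p (insert n Z). min ?k (?d i))
        = (?k - 1) + (min ?k (d n - 1) + (\<Sum>i\<in>Z. min ?k (?d i)))"
      using IFp(2-4) pn dpk by simp
    moreover have "?k * ?k = ?k * (?k - 1) + ?k" by (cases ?k) auto
    ultimately show ?thesis unfolding erdos_gallai_ineq_def sF IFp(1) using k by linarith
  qed
qed

text \<open>
  Choudum's induction: lower a maximal entry \<open>d p\<close> and a minimal positive entry \<open>d n\<close> by 1, realize
  the smaller family by a graph, and join \<open>p\<close> to \<open>n\<close>. If \<open>p\<close> and \<open>n\<close> are already adjacent, both
  degrees are raised by replacing an edge \<open>{m, z}\<close> with the edges \<open>{p, m}\<close> and \<open>{n, z}\<close>.
\<close>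

theorem erdos_gallai:
  assumes "finite I" "even (sum d I)" "\<And>F. F \<subseteq> I \<Longrightarrow> erdos_gallai_ineq I d F"
  shows "\<exists>H. fin_simple_graph I H \<and> (\<forall>i\<in>I. degree H i = d i)"
  using assms(2,3)
proof (induction "sum d I" arbitrary: d rule: less_induct)
  case less
  note fin = \<open>finite I\<close>
  show ?case
  proof (cases "sum d I = 0")
    case True
    then have "fin_simple_graph I {} \<and> (\<forall>i\<in>I. degree {} i = d i)"
      using fin by (simp add: fin_simple_graph_def degree_def)
    then show ?thesis by blast
  next
    case False
    then have "I \<noteq> {}" by auto
    then have "Max (d ` I) \<in> d ` I" using fin by simp
    then obtain p where p: "p \<in> I" "d p = Max (d ` I)" by auto
    have mx: "d i \<le> d p" if "i \<in> I" for i using that fin p by simp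
    have dp: "0 < d p" using False mx by (metis gr0I le_zero_eq sum.neutral)
    define P where "P = {i \<in> I - {p}. 0 < d i}"
    have finP: "finite P" using fin by (simp add: P_def)
    have "d p \<le> (\<Sum>i\<in>I - {p}. min 1 (d i))"
      using less.prems(2)[of "{p}"] p by (simp add: erdos_gallai_ineq_def)
    also have "\<dots> = (\<Sum>i\<in>P. 1)"
      unfolding P_def using fin by (intro sum.mono_neutral_cong_right) (auto simp: min_def)
    finally have cP: "d p \<le> card P" by simp
    then have "P \<noteq> {}" using dp by auto
    then have "Min (d ` P) \<in> d ` P" using finP by simp
    then obtain n where n: "n \<in> P" "d n = Min (d ` P)" by auto
    have mn: "d n \<le> d i" if "i \<in> P" for i using that finP n by simp
    have nI: "n \<in> I" "n \<noteq> p" "0 < d n" using n(1) by (auto simp: P_def)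
    let ?d = "d(p := d p - 1, n := d n - 1)"
    have "sum d I = d p + (d n + sum d (I - {p} - {n}))"
      using fin p nI by (simp add: sum.remove[of I p] sum.remove[of "I - {p}" n])
    moreover have "sum ?d I = d p - 1 + (d n - 1 + sum d (I - {p} - {n}))"
      using fin p nI by (simp add: sum.remove[of I p] sum.remove[of "I - {p}" n] del: sum.insert_remove)
    ultimately have s: "sum d I = sum ?d I + 2" using dp nI by simp
    have "\<exists>H. fin_simple_graph I H \<and> (\<forall>i\<in>I. degree H i = ?d i)"
    proof (rule less.hyps)
      show "sum ?d I < sum d I" "even (sum ?d I)" using s less.prems(1) by simp_all
      show "erdos_gallai_ineq I ?d F" if "F \<subseteq> I" for F
        using fin less.prems p(1) nI(1) nI(2)[symmetric] mx nI(3) that by (rule erdos_gallai_ineq_decrement)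
    qed
    then obtain H where H: "fin_simple_graph I H" and deg: "\<And>i. i \<in> I \<Longrightarrow> degree H i = ?d i"
      by blast
    have finH: "finite H" using H by (rule fin_simple_graph_finite_edges)
    have card_nb: "card (nbhd H i) = ?d i" if "i \<in> I" for i
      using deg[OF that] degree_eq_card_nbhd[OF H] by metis
    show ?thesis
    proof (cases "{p, n} \<in> H")
      case False
      have "fin_simple_graph I (insert {p, n} H)"
        using H p nI by (simp add: fin_simple_graph_def)
      moreover have "degree (insert {p, n} H) i = d i" if "i \<in> I" for i
        using degree_insert[OF finH False] deg[OF that] dp nI by auto
      ultimately show ?thesis by blast
    next
      case True
      \<comment> \<open>The inequality for \<open>{p}\<close> gives \<open>d p \<le> card P\<close>, so \<open>p\<close> misses some vertex \<open>m\<close> with \<open>0 < d m\<close>.\<close>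
      have "card (nbhd H p) < card P" using card_nb[OF p(1)] cP dp nI by simp
      then have "\<not> P \<subseteq> nbhd H p" using finite_nbhd[OF H] by (meson card_mono leD)
      then obtain m where m: "m \<in> P" "m \<notin> nbhd H p" by blast
      have mI: "m \<in> I" "m \<noteq> p" "m \<noteq> n" using m True by (auto simp: P_def nbhd_def)
      have pN: "p \<in> nbhd H n" "p \<notin> nbhd H m" using True m mem_nbhd_sym by (auto simp: nbhd_def insert_commute)
      \<comment> \<open>By minimality of \<open>d n\<close>, the degree of \<open>m\<close> in \<open>H\<close> exceeds that of \<open>n\<close>.\<close>
      have "\<not> nbhd H m - {n} \<subseteq> nbhd H n - {m, p}"
      proof
        assume sub: "nbhd H m - {n} \<subseteq> nbhd H n - {m, p}"
        have fn: "finite (nbhd H m)" "finite (nbhd H n)" using finite_nbhd[OF H] by auto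
        have cm: "card (nbhd H m) = d m" "card (nbhd H n) = d n - 1" using card_nb mI nI by auto
        have le: "card (nbhd H m - {n}) \<le> card (nbhd H n - {m, p})"
          using sub fn by (intro card_mono) auto
        show False
        proof (cases "n \<in> nbhd H m")
          case True
          then have "{m, p} \<subseteq> nbhd H n" using pN mem_nbhd_sym[of n H m] by auto
          then have "card (nbhd H n - {m, p}) = d n - 1 - 2" "2 \<le> d n - 1"
            using cm fn mI card_mono[of "nbhd H n" "{m, p}"] by (auto simp: card_Diff_subset)
          then show False using le cm True fn mn[OF m(1)] by simp
        next
          case False
          have "card (nbhd H n - {m, p}) \<le> d n - 1"
            using cm fn by (metis Diff_subset card_mono)
          then show False using le cm False mn[OF m(1)] nI by simp
        qed
      qed
      then obtain z where z: "z \<in> nbhd H m" "z \<noteq> n" "z \<notin> nbhd H n \<or> z = m \<or> z = p" by blast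
      then have z: "{m, z} \<in> H" "z \<noteq> n" "{n, z} \<notin> H" "z \<noteq> m" "z \<noteq> p" "z \<in> I"
        using pN not_in_own_nbhd[OF H, of m] nbhd_subset[OF H, of m] by (auto simp: nbhd_def)
      let ?H = "insert {p, m} (insert {n, z} (H - {{m, z}}))"
      have pm: "{p, m} \<notin> insert {n, z} (H - {{m, z}})" and nz: "{n, z} \<notin> H - {{m, z}}"
        using z m mI nI by (auto simp: nbhd_def doubleton_eq_iff)
      have "fin_simple_graph I ?H"
        using H p nI mI z by (auto simp: fin_simple_graph_def)
      moreover have "degree ?H i = d i" if "i \<in> I" for i
      proof -
        have "degree ?H i = degree (H - {{m, z}}) i + of_bool (i \<in> {n, z}) + of_bool (i \<in> {p, m})"
          using pm nz finH by (simp add: degree_insert)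
        moreover have "degree H i = degree (H - {{m, z}}) i + of_bool (i \<in> {m, z})"
          using finH z by (intro degree_remove)
        moreover have "degree H i + of_bool (i \<in> {p, n}) = d i"
          using deg[OF that] dp nI by auto
        moreover consider "i = p" | "i = n" | "i = m" | "i = z" | "i \<notin> {p, n, m, z}" by blast
        then have "of_bool (i \<in> {n, z}) + of_bool (i \<in> {p, m})
            = of_bool (i \<in> {m, z}) + (of_bool (i \<in> {p, n}) :: nat)"
          using nI mI z by cases auto
        ultimately show ?thesis by linarith
      qed
      ultimately show ?thesis by blast
    qed
  qed
qed

section \<open>Vertices of degree close to that of a heavy neighbour\<close>

text \<open>
  With \<open>h = k - g\<close> it suffices that \<open>w * (h - s) \<le> k * h\<close>. For \<open>s < h\<close> the left side is largest
  at \<open>w = s + 1 + h\<close>, where it equals \<open>h * (h + 1) - s * (s + 1)\<close>.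
\<close>

lemma quadratic_bound:
  fixes w s g k :: real
  assumes "0 \<le> w" "w \<le> s + 1 + k - g" "0 \<le> s" "1 \<le> g" "g \<le> k"
  shows "w * (w - 1) \<le> 2 * s * w + k * (k - g)"
proof -
  define h where "h = k - g"
  have h: "0 \<le> h" "h + 1 \<le> k" using assms by (auto simp: h_def)
  have "w * (w - 1 - 2 * s) \<le> w * (h - s)"
    using assms by (intro mult_left_mono) (auto simp: h_def)
  also have "\<dots> \<le> k * h"
  proof (cases "h \<le> s")
    case True
    then have "w * (h - s) \<le> 0" using assms by (simp add: mult_nonneg_nonpos)
    also have "0 \<le> k * h" using h by simp
    finally show ?thesis .
  next
    case False
    then have "w * (h - s) \<le> (s + 1 + h) * (h - s)"
      using assms by (intro mult_right_mono) (auto simp: h_def)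
    also have "\<dots> = (h + 1) * h - s * (s + 1)" by (simp add: algebra_simps)
    also have "\<dots> \<le> (h + 1) * h" using assms by simp
    also have "\<dots> \<le> k * h" using h by (intro mult_right_mono) auto
    finally show ?thesis .
  qed
  finally show ?thesis by (simp add: h_def algebra_simps)
qed

text \<open>
  Here \<open>T x\<close> stands for the set of neighbours of \<open>x\<close> outside \<open>U\<close> to which \<open>x\<close> is joined by an edge of
  small imbalance \<open>c x y\<close>. The bracket is the number of edges from \<open>y\<close> to the outside of \<open>U\<close>
  less the net amount that the edges from \<open>y\<close> to \<open>U\<close> overdraw. The brackets count an edge inside
  \<open>W\<close> from both ends although it gives back 1 only once; in the doubled balance this is
  corrected by the number of neighbours of \<open>y\<close> in \<open>W\<close>.

  The bracket equals \<open>D y - G y\<close>, where \<open>G y\<close> is the weight of the set \<open>X y\<close> of those \<open>x\<close> with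
  \<open>y \<in> T x\<close>, and where \<open>D y\<close> is at least \<open>d y\<close> and at least \<open>d x - 1\<close> for all \<open>x \<in> X y\<close>. The
  idea is to weigh an edge inside \<open>W\<close> by
  \<open>k \<le> (k - G y) + (k - G y') + sum g (X y \<inter> X y')\<close>, which holds since the weight of
  \<open>X y \<union> X y'\<close> is at most \<open>k\<close>. The first two terms are paid by the brackets at \<open>y\<close> and \<open>y'\<close>,
  of which \<open>(D y - k) * G y\<close> remains. The last one is nonzero only for edges inside a single
  \<open>T x\<close>, of which there are few as \<open>card (T x) \<le> d x - g x\<close>. Since \<open>G y\<close> is a sum over
  \<open>X y\<close>, the balance then splits into one quadratic inequality for each \<open>x\<close>.
\<close>

lemma near_neighbour_excess_bound:
  fixes g d :: "'a \<Rightarrow> real" and c :: "'a \<Rightarrow> 'a \<Rightarrow> real" and k :: real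
  assumes finU: "finite U" and finT: "\<And>x. x \<in> U \<Longrightarrow> finite (T x)"
    and W: "W = (\<Union>x\<in>U. T x)"
    and g1: "\<And>x. x \<in> U \<Longrightarrow> 1 \<le> g x" and gk: "sum g U = k"
    and dU: "\<And>x. x \<in> U \<Longrightarrow> k + 1 \<le> d x"
    and cT: "\<And>x. x \<in> U \<Longrightarrow> real (card (T x)) \<le> d x - g x"
    and c1: "\<And>x y. x \<in> U \<Longrightarrow> y \<in> T x \<Longrightarrow> 1 \<le> c x y"
    and near: "\<And>x y. x \<in> U \<Longrightarrow> y \<in> T x \<Longrightarrow> d x \<le> d y + c x y"
    and irr: "\<And>y. y \<notin> nbhd E y"
    and dN: "\<And>y. y \<in> W \<Longrightarrow> real (card (nbhd E y \<inter> W)) \<le> d y"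
  shows "(\<Sum>y\<in>W. real (card (nbhd E y \<inter> W)) - 2 * (d y - (\<Sum>x | x \<in> U \<and> y \<in> T x. 1 + g x - c x y)))
          \<le> (\<Sum>x\<in>U. g x * (k - g x))"
proof (cases "U = {}")
  case True
  then show ?thesis using W by simp
next
  case False
  have g0: "0 \<le> g x" if "x \<in> U" for x using g1[OF that] by simp
  have gle: "sum g A \<le> k" if "A \<subseteq> U" for A
    unfolding gk[symmetric] using finU that g0 by (intro sum_mono2) auto
  have gxk: "g x \<le> k" if "x \<in> U" for x using gle[of "{x}"] that by simp
  have k1: "1 \<le> k" using False g1 gxk by (metis all_not_in_conv order_trans)
  have finW: "finite W" using W finU finT by auto
  define X where "X y = {x. x \<in> U \<and> y \<in> T x}" for y
  define G where "G y = sum g (X y)" for y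
  define D where "D y = d y + (\<Sum>x\<in>X y. c x y - 1)" for y
  define deg where "deg y = real (card (nbhd E y \<inter> W))" for y
  have XU: "X y \<subseteq> U" and finX: "finite (X y)" for y using finU by (auto simp: X_def)
  have Gk: "G y \<le> k" for y unfolding G_def using XU by (rule gle)
  have ext: "d y - (\<Sum>x\<in>X y. 1 + g x - c x y) = D y - G y" for y
    by (simp add: D_def G_def sum_subtractf sum.distrib)
  have dD: "d y \<le> D y" for y
    unfolding D_def using c1 by (auto simp: X_def intro!: sum_nonneg)
  have sD: "d x - 1 \<le> D y" if "x \<in> X y" for x y
  proof -
    have "c x y - 1 \<le> (\<Sum>x\<in>X y. c x y - 1)"
      using that finX c1 by (intro member_le_sum) (auto simp: X_def)
    then show ?thesis unfolding D_def using near that by (force simp: X_def)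
  qed
  have swapX: "(\<Sum>y\<in>W. \<Sum>x\<in>X y. f x y) = (\<Sum>x\<in>U. \<Sum>y\<in>T x. f x y)" for f :: "'a \<Rightarrow> 'a \<Rightarrow> real"
  proof -
    have "(\<Sum>y\<in>W. \<Sum>x\<in>X y. f x y) = (\<Sum>x\<in>U. \<Sum>y | y \<in> W \<and> y \<in> T x. f x y)"
      unfolding X_def using finW finU by (rule sum.swap_restrict)
    also have "\<dots> = (\<Sum>x\<in>U. \<Sum>y\<in>T x. f x y)"
      using W by (intro sum.cong) auto
    finally show ?thesis .
  qed
  have pair: "k \<le> (k - G y) + (k - G y') + sum g (X y \<inter> X y')" for y y'
  proof -
    have "G y + G y' = sum g (X y \<union> X y') + sum g (X y \<inter> X y')"
      unfolding G_def using finX by (simp add: sum.union_inter)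
    then show ?thesis using gle[of "X y \<union> X y'"] XU by simp
  qed
  have common: "(\<Sum>y\<in>W. \<Sum>y'\<in>nbhd E y \<inter> W. sum g (X y \<inter> X y'))
      \<le> (\<Sum>x\<in>U. g x * (real (card (T x)) * (real (card (T x)) - 1)))"
  proof -
    have inter: "sum g (X y \<inter> X y') = (\<Sum>x\<in>X y. if y' \<in> T x then g x else 0)" for y y'
    proof -
      have "X y \<inter> X y' = {x \<in> X y. y' \<in> T x}" by (auto simp: X_def)
      then show ?thesis using finX by (simp add: sum.inter_filter)
    qed
    have "(\<Sum>y\<in>W. \<Sum>y'\<in>nbhd E y \<inter> W. sum g (X y \<inter> X y'))
        = (\<Sum>y\<in>W. \<Sum>y'\<in>nbhd E y \<inter> W. \<Sum>x\<in>X y. if y' \<in> T x then g x else 0)"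
      by (simp only: inter)
    also have "\<dots> = (\<Sum>y\<in>W. \<Sum>x\<in>X y. \<Sum>y'\<in>nbhd E y \<inter> W. if y' \<in> T x then g x else 0)"
      by (intro sum.cong refl sum.swap)
    also have "\<dots> = (\<Sum>x\<in>U. \<Sum>y\<in>T x. \<Sum>y'\<in>nbhd E y \<inter> W. if y' \<in> T x then g x else 0)"
      by (rule swapX)
    also have "\<dots> \<le> (\<Sum>x\<in>U. \<Sum>y\<in>T x. g x * (real (card (T x)) - 1))"
    proof (intro sum_mono)
      fix x y assume xy: "x \<in> U" "y \<in> T x"
      have "card {y' \<in> nbhd E y \<inter> W. y' \<in> T x} \<le> card (T x - {y})"
        using finT[OF xy(1)] irr by (intro card_mono) auto
      also have "real (card (T x - {y})) = real (card (T x)) - 1"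
        using card_Suc_Diff1[OF finT[OF xy(1)] xy(2)] by linarith
      finally have "g x * real (card {y' \<in> nbhd E y \<inter> W. y' \<in> T x}) \<le> g x * (real (card (T x)) - 1)"
        using g0[OF xy(1)] by (intro mult_left_mono) auto
      then show "(\<Sum>y'\<in>nbhd E y \<inter> W. if y' \<in> T x then g x else 0) \<le> g x * (real (card (T x)) - 1)"
        using finW by (simp flip: sum.inter_filter add: mult.commute)
    qed
    finally show ?thesis by (simp add: algebra_simps)
  qed
  have "k * (\<Sum>y\<in>W. deg y) = (\<Sum>y\<in>W. \<Sum>y'\<in>nbhd E y \<inter> W. k)"
    by (simp add: deg_def sum_distrib_left mult.commute)
  also have "\<dots> \<le> (\<Sum>y\<in>W. \<Sum>y'\<in>nbhd E y \<inter> W. (k - G y) + (k - G y') + sum g (X y \<inter> X y'))"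
    by (intro sum_mono pair)
  also have "\<dots> = (\<Sum>y\<in>W. \<Sum>y'\<in>nbhd E y \<inter> W. k - G y) + (\<Sum>y\<in>W. \<Sum>y'\<in>nbhd E y \<inter> W. k - G y')
      + (\<Sum>y\<in>W. \<Sum>y'\<in>nbhd E y \<inter> W. sum g (X y \<inter> X y'))"
    by (simp only: sum.distrib)
  also have "(\<Sum>y\<in>W. \<Sum>y'\<in>nbhd E y \<inter> W. k - G y') = (\<Sum>y\<in>W. \<Sum>y'\<in>nbhd E y \<inter> W. k - G y)"
    using finW finW by (rule sum_swap_nbhd)
  also have "(\<Sum>y\<in>W. \<Sum>y'\<in>nbhd E y \<inter> W. k - G y) = (\<Sum>y\<in>W. deg y * (k - G y))"
    by (simp add: deg_def)
  finally have A: "k * (\<Sum>y\<in>W. deg y) \<le> 2 * (\<Sum>y\<in>W. deg y * (k - G y))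
      + (\<Sum>x\<in>U. g x * (real (card (T x)) * (real (card (T x)) - 1)))"
    using common by linarith
  have "deg y * (k - G y) - k * (D y - G y) \<le> - (\<Sum>x\<in>X y. g x * (d x - 1 - k))" if "y \<in> W" for y
  proof -
    have "deg y * (k - G y) \<le> D y * (k - G y)"
      using dN[OF that] dD[of y] Gk by (intro mult_right_mono) (auto simp: deg_def)
    then have "deg y * (k - G y) - k * (D y - G y) \<le> - (G y * (D y - k))"
      by (simp add: algebra_simps)
    also have "G y * (D y - k) = (\<Sum>x\<in>X y. g x * (D y - k))"
      by (simp add: G_def sum_distrib_right)
    also have "- \<dots> \<le> - (\<Sum>x\<in>X y. g x * (d x - 1 - k))"
      using sD g0 subsetD[OF XU[of y]] by (intro le_imp_neg_le sum_mono mult_left_mono) (auto simp: algebra_simps)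
    finally show ?thesis .
  qed
  then have "(\<Sum>y\<in>W. deg y * (k - G y) - k * (D y - G y)) \<le> (\<Sum>y\<in>W. - (\<Sum>x\<in>X y. g x * (d x - 1 - k)))"
    by (intro sum_mono)
  also have "\<dots> = - (\<Sum>x\<in>U. real (card (T x)) * (g x * (d x - 1 - k)))"
    by (simp add: sum_negf swapX)
  finally have B: "(\<Sum>y\<in>W. deg y * (k - G y)) - k * (\<Sum>y\<in>W. D y - G y)
      \<le> - (\<Sum>x\<in>U. real (card (T x)) * (g x * (d x - 1 - k)))"
    by (simp add: sum_subtractf sum_distrib_left right_diff_distrib)
  have "k * (\<Sum>y\<in>W. deg y - 2 * (D y - G y)) = k * (\<Sum>y\<in>W. deg y) - 2 * (k * (\<Sum>y\<in>W. D y - G y))"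
    by (simp add: sum_subtractf sum.distrib sum_distrib_left algebra_simps)
  also have "\<dots> \<le> (\<Sum>x\<in>U. g x * (real (card (T x)) * (real (card (T x)) - 1)))
      - 2 * (\<Sum>x\<in>U. real (card (T x)) * (g x * (d x - 1 - k)))"
    using A B by linarith
  also have "\<dots> = (\<Sum>x\<in>U. g x * (real (card (T x)) * (real (card (T x)) - 1) - 2 * (d x - 1 - k) * real (card (T x))))"
    by (simp add: sum_subtractf sum.distrib sum_distrib_left algebra_simps)
  also have "\<dots> \<le> (\<Sum>x\<in>U. g x * (k * (k - g x)))"
  proof (intro sum_mono mult_left_mono)
    fix x assume x: "x \<in> U"
    show "real (card (T x)) * (real (card (T x)) - 1) - 2 * (d x - 1 - k) * real (card (T x)) \<le> k * (k - g x)"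
      using quadratic_bound[of "real (card (T x))" "d x - 1 - k" k "g x"] cT[OF x] dU[OF x] g1[OF x] gxk[OF x]
      by simp
  qed (use g0 in auto)
  also have "\<dots> = k * (\<Sum>x\<in>U. g x * (k - g x))"
    by (simp add: sum_distrib_left algebra_simps)
  finally have "(\<Sum>y\<in>W. deg y - 2 * (D y - G y)) \<le> (\<Sum>x\<in>U. g x * (k - g x))"
    using k1 by simp
  then show ?thesis by (simp only: ext[symmetric] deg_def X_def)
qed

section \<open>The criterion for imbalances\<close>

text \<open>
  The charging argument. On an edge outside \<open>F\<close>, \<open>\<psi>\<close> is the charge less the value of the edge on the
  right side of the inequality; on an edge of \<open>F\<close>, it is the charge from the end of
  smaller degree, plus a share 1 of \<open>k = k\<^sup>2 - k * (k - 1)\<close>, less the smaller degree; the charges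
  from the ends of larger degree are accounted for in \<open>S\<close>. With this, the claim reads
  \<open>sum \<psi> E \<le> S\<close>. Each edge is counted from both ends, and \<open>\<psi>\<close> is bounded by \<open>g u * g v\<close> for
  two ends in \<open>U\<close>, by \<open>b\<close> for one end in \<open>U\<close> and by \<open>-1\<close> otherwise. Here \<open>b\<close> refers to the set
  \<open>W\<close> of vertices outside \<open>U\<close> that are joined to some \<open>x \<in> U\<close> by an edge outside \<open>F\<close> of imbalance at
  most \<open>g x\<close>; the excess at these vertices is what \<open>near_neighbour_excess_bound\<close> controls.
\<close>

lemma imbalance_erdos_gallai_ineq:
  assumes G: "fin_simple_graph V E" and pos: "\<And>e. e \<in> E \<Longrightarrow> 0 < imb E e"
    and FE: "F \<subseteq> E" and large: "\<And>e. e \<in> F \<Longrightarrow> card F \<le> imb E e"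
  shows "erdos_gallai_ineq E (imb E) F"
proof (cases "F = {}")
  case True
  then show ?thesis by (simp add: erdos_gallai_ineq_def)
next
  case False
  have finE: "finite E" using G by (rule fin_simple_graph_finite_edges)
  have finF: "finite F" using FE finE by (rule finite_subset)
  have finV: "finite V" using G by (simp add: fin_simple_graph_def)
  define k where "k = card F"
  have k1: "1 \<le> k" using False finF by (simp add: k_def card_gt_0_iff Suc_le_eq)
  let ?d = "degree E" and ?N = "nbhd E"
  note dN = degree_eq_card_nbhd[OF G]
  note finN = finite_nbhd[OF G]
  have edge: "imb E {u, v} = nat \<bar>int (?d u) - int (?d v)\<bar>" for u v by (rule imb_insert)
  have "\<forall>e\<in>E. \<exists>u v. e = {u, v} \<and> ?d v < ?d u \<and> imb E e = ?d u - ?d v"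
  proof
    fix e assume e: "e \<in> E"
    then obtain u v where uv: "e = {u, v}" using edge_cases[OF G] by metis
    have "?d u \<noteq> ?d v" using pos[OF e] unfolding uv edge by auto
    then consider "?d v < ?d u" | "?d u < ?d v" by linarith
    then show "\<exists>u v. e = {u, v} \<and> ?d v < ?d u \<and> imb E e = ?d u - ?d v"
    proof cases
      case 1
      then show ?thesis using uv edge[of u v] by (intro exI[of _ u] exI[of _ v]) auto
    next
      case 2
      then show ?thesis using uv edge[of u v] by (intro exI[of _ v] exI[of _ u]) auto
    qed
  qed
  then obtain h l where hl: "\<And>e. e \<in> E \<Longrightarrow> {h e, l e} = e"
    and dhl: "\<And>e. e \<in> E \<Longrightarrow> ?d (l e) < ?d (h e)"
    and imbhl: "\<And>e. e \<in> E \<Longrightarrow> imb E e = ?d (h e) - ?d (l e)"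
    by metis
  have hmem: "h e \<in> e" and lmem: "l e \<in> e" if "e \<in> E" for e using hl[OF that] by blast+
  have dpos: "1 \<le> ?d v" if "e \<in> E" "v \<in> e" for e v
    unfolding degree_def using that finE by (auto simp: Suc_le_eq card_gt_0_iff)
  define g where "g u = card {e \<in> F. h e = u}" for u
  define U where "U = h ` F"
  have finU: "finite U" using finF by (simp add: U_def)
  have UV: "U \<subseteq> V"
    unfolding U_def using hmem FE G unfolding fin_simple_graph_def by blast
  have gU: "1 \<le> g u \<longleftrightarrow> u \<in> U" for u
    using finF by (auto simp: g_def U_def Suc_le_eq card_gt_0_iff)
  have g0: "g u = 0" if "u \<notin> U" for u using gU[of u] that by simp
  have sumF: "(\<Sum>e\<in>F. f (h e)) = (\<Sum>u\<in>U. real (g u) * f u)" for f :: "'a \<Rightarrow> real"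
    using sum.image_gen[OF finF, of "\<lambda>e. f (h e)" h] by (simp add: g_def U_def)
  have gk: "(\<Sum>u\<in>U. real (g u)) = real k"
    using sumF[of "\<lambda>_. 1"] by (simp add: k_def)
  have gle: "sum g A \<le> k" if "A \<subseteq> U" for A
    using sum_mono2[OF finU that, of g] gk by (metis of_nat_eq_iff of_nat_sum zero_le)
  have gxk: "g x \<le> k" for x using gle[of "{x}"] g0 by (cases "x \<in> U") auto
  have gxx: "g x + g x' \<le> k" if "x \<in> U" "x' \<in> U" "x \<noteq> x'" for x x'
    using gle[of "{x, x'}"] that by simp
  have dU: "k + 1 \<le> ?d x" if "x \<in> U" for x
  proof -
    obtain e where e: "e \<in> F" "x = h e" using \<open>x \<in> U\<close> by (auto simp: U_def)
    then have "1 \<le> ?d (l e)" using FE by (intro dpos[of e] lmem) auto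
    moreover have "imb E e = ?d (h e) - ?d (l e)" using e FE by (intro imbhl) auto
    ultimately show ?thesis using large[OF e(1)] \<open>F \<noteq> {}\<close> finF card_0_eq[of F] unfolding k_def e(2) by linarith
  qed
  \<comment> \<open>Equality \<open>imb = g x\<close> is included although such an edge does not overdraw: then all other edges from \<open>W\<close> to \<open>U\<close> have a surplus of at least 1.\<close>
  define T where "T x = {y \<in> ?N x. y \<notin> U \<and> {x, y} \<notin> F \<and> imb E {x, y} \<le> g x}" for x
  define W where "W = (\<Union>x\<in>U. T x)"
  have TN: "T x \<subseteq> ?N x" for x by (auto simp: T_def)
  have finT: "finite (T x)" for x using TN finN by (rule finite_subset)
  have finW: "finite W" using finU finT by (simp add: W_def)
  have WU: "W \<inter> U = {}" and WV: "W \<subseteq> V" using nbhd_subset[OF G] by (auto simp: W_def T_def)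
  \<comment> \<open>The \<open>g x\<close> edges of \<open>F\<close> at \<open>x\<close> lead to neighbours outside \<open>T x\<close>.\<close>
  have cT: "card (T x) + g x \<le> ?d x" for x
  proof -
    have "inj_on l {e \<in> F. h e = x}"
    proof (rule inj_onI)
      fix e e' assume "e \<in> {e \<in> F. h e = x}" "e' \<in> {e \<in> F. h e = x}" "l e = l e'"
      then show "e = e'" using hl[of e] hl[of e'] FE by auto
    qed
    then have "g x = card (l ` {e \<in> F. h e = x})" by (simp add: g_def card_image)
    moreover have "l ` {e \<in> F. h e = x} \<subseteq> ?N x - T x"
    proof clarify
      fix e assume e: "e \<in> F" "x = h e"
      then have "{h e, l e} = e" "e \<in> E" using hl FE by auto
      then show "l e \<in> ?N (h e) - T (h e)" using e(1) by (simp add: nbhd_def T_def)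
    qed
    ultimately have "g x \<le> card (?N x - T x)" using finN by (simp add: card_mono)
    also have "\<dots> = ?d x - card (T x)" using dN finT TN by (simp add: card_Diff_subset)
    finally show ?thesis using card_mono[OF finN[of x] TN[of x]] dN[of x] by linarith
  qed
  define S where "S = (\<Sum>x\<in>U. real (g x) * (real k - real (g x)))"
  let ?D = "\<lambda>v. real (?d v)" and ?g = "\<lambda>v. real (g v)" and ?c = "\<lambda>x y. real (imb E {x, y})"
  have core: "(\<Sum>y\<in>W. real (card (?N y \<inter> W)) - 2 * (?D y - (\<Sum>x | x \<in> U \<and> y \<in> T x. 1 + ?g x - ?c x y))) \<le> S"
    unfolding S_def
  proof (rule near_neighbour_excess_bound[where T = T])
    show "1 \<le> ?g x" if "x \<in> U" for x using that gU[of x] by simp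
    show "real k + 1 \<le> ?D x" if "x \<in> U" for x using dU[OF that] by simp
    show "real (card (T x)) \<le> ?D x - ?g x" for x using cT[of x] by linarith
    show "1 \<le> ?c x y" if "y \<in> T x" for x y using pos[of "{x, y}"] that by (auto simp: T_def nbhd_def)
    show "?D x \<le> ?D y + ?c x y" for x y unfolding edge by linarith
    show "real (card (?N y \<inter> W)) \<le> ?D y" for y unfolding dN using finN by (simp add: card_mono)
  qed (use finU finT W_def gk not_in_own_nbhd[OF G] in auto)

  define \<psi> where "\<psi> e = (if e \<in> F then 1 + ?g (l e) - ?D (l e)
      else (\<Sum>v\<in>e. ?g v) - real (min k (imb E e)))" for e
  define b where "b y x = (if y \<in> T x then ?g x - ?c x y else if y \<in> W then -1 else 0)" for y x
  have UUb: "\<psi> {x, y} \<le> ?g x * ?g y" if "y \<in> ?N x" "x \<in> U" "y \<in> U" for x y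
  proof (cases "{x, y} \<in> F")
    case True
    then have "l {x, y} \<in> U" using lmem[OF subsetD[OF FE True]] that by auto
    then have "\<psi> {x, y} \<le> 0" using True dU[of "l {x, y}"] gxk[of "l {x, y}"] by (simp add: \<psi>_def)
    also have "0 \<le> ?g x * ?g y" by simp
    finally show ?thesis .
  next
    case False
    have "x \<noteq> y" using that not_in_own_nbhd[OF G] by auto
    have "1 \<le> imb E {x, y}" using pos[of "{x, y}"] that by (auto simp: nbhd_def)
    then have "\<psi> {x, y} \<le> ?g x + ?g y - 1" using False k1 \<open>x \<noteq> y\<close> by (simp add: \<psi>_def)
    also have "\<dots> \<le> ?g x * ?g y"
    proof -
      have "0 \<le> (?g x - 1) * (?g y - 1)" using gU[of x] gU[of y] that by (intro mult_nonneg_nonneg) auto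
      then show ?thesis by (simp add: algebra_simps)
    qed
    finally show ?thesis .
  qed
  have UYb: "\<psi> {x, y} \<le> b y x" if xy: "y \<in> ?N x" "x \<in> U" "y \<notin> U" for x y
  proof (cases "{x, y} \<in> F")
    case True
    then have "h {x, y} \<in> U" by (auto simp: U_def)
    then have hx: "h {x, y} = x" "l {x, y} = y"
      using hl[OF subsetD[OF FE True]] xy by (auto simp: doubleton_eq_iff)
    have yT: "y \<notin> T x" using True by (simp add: T_def)
    have \<psi>: "\<psi> {x, y} = 1 - ?D y" using True hx g0 xy by (simp add: \<psi>_def)
    show ?thesis
    proof (cases "y \<in> W")
      case True
      then obtain x' where x': "x' \<in> U" "y \<in> T x'" by (auto simp: W_def)
      \<comment> \<open>The smaller degree of this edge of \<open>F\<close> is at least 2, which gives the surplus.\<close>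
      then have "{x, x'} \<subseteq> ?N y" "x \<noteq> x'" using xy yT TN by (auto simp: mem_nbhd_sym[of _ E y])
      then have "2 \<le> ?d y" unfolding dN using card_mono[OF finN, of "{x, x'}"] by fastforce
      then show ?thesis using \<psi> yT True by (simp add: b_def)
    next
      case False
      have "1 \<le> ?d y" using dpos[of "{x, y}" y] xy by (simp add: nbhd_def)
      then show ?thesis using \<psi> yT False by (simp add: b_def)
    qed
  next
    case False
    have "x \<noteq> y" using xy by auto
    then have \<psi>: "\<psi> {x, y} = ?g x - real (min k (imb E {x, y}))"
      using False g0 xy by (simp add: \<psi>_def)
    show ?thesis
    proof (cases "y \<in> T x")
      case True
      then have "imb E {x, y} \<le> k" using gxk[of x] by (simp add: T_def)
      then show ?thesis using True \<psi> by (simp add: b_def)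
    next
      case yT: False
      then have c: "g x < imb E {x, y}" using False xy by (simp add: T_def)
      show ?thesis
      proof (cases "y \<in> W")
        case True
        then obtain x' where x': "x' \<in> U" "y \<in> T x'" by (auto simp: W_def)
        \<comment> \<open>A second vertex of \<open>U\<close> forces \<open>g x < k\<close>, so that the minimum with \<open>k\<close> does not spoil the surplus.\<close>
        then have "g x + g x' \<le> k" using yT xy by (intro gxx) auto
        then have "g x + 1 \<le> min k (imb E {x, y})" using c gU[of x'] x' by simp
        then have "\<psi> {x, y} \<le> -1" unfolding \<psi> by linarith
        then show ?thesis using yT True by (simp add: b_def)
      next
        case False
        have "g x \<le> min k (imb E {x, y})" using c gxk[of x] by simp
        then have "\<psi> {x, y} \<le> 0" unfolding \<psi> by linarith
        then show ?thesis using yT False by (simp add: b_def)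
      qed
    qed
  qed
  have YYb: "\<psi> {x, y} \<le> -1" if xy: "y \<in> ?N x" "x \<notin> U" "y \<notin> U" for x y
  proof -
    have "{x, y} \<in> E" "x \<noteq> y" using xy not_in_own_nbhd[OF G] by (auto simp: nbhd_def)
    have "h {x, y} \<notin> U" using hmem[OF \<open>{x, y} \<in> E\<close>] xy by auto
    then have "{x, y} \<notin> F" unfolding U_def by blast
    moreover have "1 \<le> imb E {x, y}" using pos \<open>{x, y} \<in> E\<close> by (simp add: Suc_le_eq)
    ultimately show ?thesis using g0 xy k1 \<open>x \<noteq> y\<close> by (simp add: \<psi>_def)
  qed

  have NUV: "sum f (?N v) = sum f (?N v \<inter> U) + sum f (?N v \<inter> (V - U))" for f :: "'a \<Rightarrow> real" and v
  proof -
    have "?N v = (?N v \<inter> U) \<union> (?N v \<inter> (V - U))" using nbhd_subset[OF G] by auto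
    then have "sum f (?N v) = sum f ((?N v \<inter> U) \<union> (?N v \<inter> (V - U)))" by simp
    also have "\<dots> = sum f (?N v \<inter> U) + sum f (?N v \<inter> (V - U))"
      using finN by (intro sum.union_disjoint) auto
    finally show ?thesis .
  qed
  have "2 * (\<Sum>e\<in>E. \<psi> e) = (\<Sum>v\<in>V. \<Sum>w\<in>?N v. \<psi> {v, w})"
    using sum_arcs[OF G] by simp
  also have "\<dots> = (\<Sum>v\<in>U. \<Sum>w\<in>?N v. \<psi> {v, w}) + (\<Sum>v\<in>V - U. \<Sum>w\<in>?N v. \<psi> {v, w})"
    using finV UV by (simp add: sum.subset_diff)
  also have "\<dots> = (\<Sum>v\<in>U. \<Sum>w\<in>?N v \<inter> U. \<psi> {v, w}) + (\<Sum>v\<in>U. \<Sum>w\<in>?N v \<inter> (V - U). \<psi> {v, w})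
      + (\<Sum>v\<in>V - U. (\<Sum>w\<in>?N v \<inter> U. \<psi> {v, w}) + (\<Sum>w\<in>?N v \<inter> (V - U). \<psi> {v, w}))"
    unfolding NUV by (simp add: sum.distrib)
  also have "\<dots> \<le> (\<Sum>v\<in>U. \<Sum>w\<in>?N v \<inter> U. ?g v * ?g w) + (\<Sum>v\<in>U. \<Sum>w\<in>?N v \<inter> (V - U). b w v)
      + (\<Sum>v\<in>V - U. (\<Sum>w\<in>?N v \<inter> U. b v w) + (\<Sum>w\<in>?N v \<inter> (V - U). -1))"
  proof (intro add_mono sum_mono)
    fix v w assume "v \<in> V - U" "w \<in> ?N v \<inter> U"
    then show "\<psi> {v, w} \<le> b v w" using UYb[of v w] mem_nbhd_sym[of v E w] by (auto simp: insert_commute)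
  qed (use UUb UYb YYb in auto)
  also have "(\<Sum>v\<in>U. \<Sum>w\<in>?N v \<inter> (V - U). b w v) = (\<Sum>v\<in>V - U. \<Sum>w\<in>?N v \<inter> U. b v w)"
    using finU finV by (intro sum_swap_nbhd) auto
  finally have twice: "2 * (\<Sum>e\<in>E. \<psi> e) \<le> (\<Sum>v\<in>U. \<Sum>w\<in>?N v \<inter> U. ?g v * ?g w)
      + (\<Sum>v\<in>V - U. 2 * (\<Sum>w\<in>?N v \<inter> U. b v w) - real (card (?N v \<inter> (V - U))))"
    by (simp add: sum.distrib sum_subtractf sum_negf flip: sum_distrib_left)

  have UU: "(\<Sum>v\<in>U. \<Sum>w\<in>?N v \<inter> U. ?g v * ?g w) \<le> S"
    unfolding S_def
  proof (intro sum_mono)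
    fix v assume v: "v \<in> U"
    have "(\<Sum>w\<in>?N v \<inter> U. ?g v * ?g w) \<le> (\<Sum>w\<in>U - {v}. ?g v * ?g w)"
      using finU not_in_own_nbhd[OF G] by (intro sum_mono2) auto
    also have "\<dots> = ?g v * (real k - ?g v)"
      using finU v gk by (simp add: sum.remove[of U v] flip: sum_distrib_left)
    finally show "(\<Sum>w\<in>?N v \<inter> U. ?g v * ?g w) \<le> ?g v * (real k - ?g v)" .
  qed

  \<comment> \<open>Vertices of \<open>Q\<close> overdraw nothing; their edges to \<open>W\<close> are credited to \<open>W\<close> from both ends.\<close>
  define Q where "Q = V - U - W"
  have VUW: "V - U = W \<union> Q" "W \<inter> Q = {}" "finite Q" using WU WV finV by (auto simp: Q_def)
  have cardWQ: "card (?N y \<inter> (V - U)) = card (?N y \<inter> W) + card (?N y \<inter> Q)" for y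
    unfolding VUW(1) Int_Un_distrib using finN VUW(2) by (intro card_Un_disjoint) auto
  have Wterm: "2 * (\<Sum>x\<in>?N y \<inter> U. b y x) - real (card (?N y \<inter> (V - U)))
      = (real (card (?N y \<inter> W)) - 2 * (?D y - (\<Sum>x | x \<in> U \<and> y \<in> T x. 1 + ?g x - ?c x y)))
        + real (card (?N y \<inter> Q))" if y: "y \<in> W" for y
  proof -
    have "(\<Sum>x\<in>?N y \<inter> U. b y x) = (\<Sum>x\<in>?N y \<inter> U. (if y \<in> T x then 1 + ?g x - ?c x y else 0) - 1)"
      using y by (intro sum.cong) (auto simp: b_def)
    also have "\<dots> = (\<Sum>x\<in>?N y \<inter> U. if y \<in> T x then 1 + ?g x - ?c x y else 0) - real (card (?N y \<inter> U))"
      by (simp add: sum_subtractf)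
    also have "(\<Sum>x\<in>?N y \<inter> U. if y \<in> T x then 1 + ?g x - ?c x y else 0)
        = (\<Sum>x | x \<in> U \<and> y \<in> T x. 1 + ?g x - ?c x y)"
    proof -
      have "{x \<in> ?N y \<inter> U. y \<in> T x} = {x. x \<in> U \<and> y \<in> T x}"
        using TN by (auto simp: mem_nbhd_sym[of _ E y])
      then show ?thesis using finU by (simp flip: sum.inter_filter)
    qed
    finally have "(\<Sum>x\<in>?N y \<inter> U. b y x)
        = (\<Sum>x | x \<in> U \<and> y \<in> T x. 1 + ?g x - ?c x y) - real (card (?N y \<inter> U))" .
    moreover have "?D y = real (card (?N y \<inter> U)) + real (card (?N y \<inter> (V - U)))"
      using NUV[of "\<lambda>_. 1" y] by (simp add: dN)
    ultimately show ?thesis using cardWQ[of y] by simp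
  qed
  have Qterm: "2 * (\<Sum>x\<in>?N y \<inter> U. b y x) - real (card (?N y \<inter> (V - U))) \<le> - real (card (?N y \<inter> W))"
    if y: "y \<in> Q" for y
  proof -
    have "(\<Sum>x\<in>?N y \<inter> U. b y x) = 0"
      using y by (intro sum.neutral) (auto simp: b_def Q_def W_def)
    then show ?thesis using cardWQ[of y] by simp
  qed
  have "(\<Sum>v\<in>V - U. 2 * (\<Sum>w\<in>?N v \<inter> U. b v w) - real (card (?N v \<inter> (V - U))))
      = (\<Sum>v\<in>W. 2 * (\<Sum>w\<in>?N v \<inter> U. b v w) - real (card (?N v \<inter> (V - U))))
      + (\<Sum>v\<in>Q. 2 * (\<Sum>w\<in>?N v \<inter> U. b v w) - real (card (?N v \<inter> (V - U))))"
    unfolding VUW(1) using finW VUW by (intro sum.union_disjoint) auto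
  also have "\<dots> \<le> (\<Sum>y\<in>W. (real (card (?N y \<inter> W)) - 2 * (?D y - (\<Sum>x | x \<in> U \<and> y \<in> T x. 1 + ?g x - ?c x y)))
        + real (card (?N y \<inter> Q))) + (\<Sum>y\<in>Q. - real (card (?N y \<inter> W)))"
    using Wterm Qterm by (intro add_mono sum_mono) auto
  also have "\<dots> \<le> S + ((\<Sum>y\<in>W. real (card (?N y \<inter> Q))) - (\<Sum>y\<in>Q. real (card (?N y \<inter> W))))"
    using core by (simp add: sum.distrib sum_negf)
  also have "(\<Sum>y\<in>W. real (card (?N y \<inter> Q))) = (\<Sum>y\<in>Q. real (card (?N y \<inter> W)))"
    using sum_swap_nbhd[OF finW VUW(3), of "\<lambda>_ _. 1::real" E] by simp
  finally have \<psi>S: "(\<Sum>e\<in>E. \<psi> e) \<le> S" using twice UU by linarith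

  define M where "M = (\<Sum>e\<in>E - F. real (min k (imb E e)))"
  have "(\<Sum>e\<in>E. \<Sum>v\<in>e. ?g v) = (\<Sum>v\<in>V. \<Sum>w\<in>?N v. ?g v)"
    using sum_incidence[OF G, of "\<lambda>v e. ?g v"] by simp
  also have "\<dots> = (\<Sum>v\<in>V. ?g v * ?D v)" by (simp add: dN mult.commute)
  also have "\<dots> = (\<Sum>v\<in>U. ?g v * ?D v)"
    using finV UV g0 by (intro sum.mono_neutral_right) auto
  also have "\<dots> = (\<Sum>e\<in>F. ?D (h e))" by (rule sumF[symmetric])
  finally have total: "(\<Sum>e\<in>E. \<Sum>v\<in>e. ?g v) = (\<Sum>e\<in>F. ?D (h e))" .
  have split: "sum f E = sum f F + sum f (E - F)" for f :: "'a set \<Rightarrow> real"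
    using sum.subset_diff[OF FE finE, of f] by simp
  have "(\<Sum>e\<in>F. \<Sum>v\<in>e. ?g v) = (\<Sum>e\<in>F. ?g (h e) + ?g (l e))"
  proof (intro sum.cong refl)
    fix e assume "e \<in> F"
    then have e: "e \<in> E" using FE by auto
    have "h e \<noteq> l e" using dhl[OF e] by auto
    then have "(\<Sum>v\<in>{h e, l e}. ?g v) = ?g (h e) + ?g (l e)" by simp
    then show "(\<Sum>v\<in>e. ?g v) = ?g (h e) + ?g (l e)" using hl[OF e] by simp
  qed
  then have onF: "(\<Sum>e\<in>F. \<Sum>v\<in>e. ?g v) = (\<Sum>u\<in>U. ?g u * ?g u) + (\<Sum>e\<in>F. ?g (l e))"
    using sumF[of ?g] by (simp add: sum.distrib)
  have "(\<Sum>e\<in>E. \<psi> e) = (\<Sum>e\<in>F. 1 + ?g (l e) - ?D (l e)) + (\<Sum>e\<in>E - F. (\<Sum>v\<in>e. ?g v) - real (min k (imb E e)))"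
    unfolding split[of \<psi>] by (simp add: \<psi>_def)
  also have "\<dots> = real k + (\<Sum>e\<in>F. ?g (l e)) - (\<Sum>e\<in>F. ?D (l e)) + (\<Sum>e\<in>E - F. \<Sum>v\<in>e. ?g v) - M"
    by (simp add: sum.distrib sum_subtractf k_def M_def)
  finally have \<psi>sum: "(\<Sum>e\<in>E. \<psi> e) = real k + (\<Sum>e\<in>F. ?D (h e)) - (\<Sum>e\<in>F. ?D (l e)) - (\<Sum>u\<in>U. ?g u * ?g u) - M"
    using total split[of "\<lambda>e. \<Sum>v\<in>e. ?g v"] onF by simp
  have "(\<Sum>e\<in>F. real (imb E e)) = (\<Sum>e\<in>F. ?D (h e) - ?D (l e))"
    using imbhl dhl FE by (intro sum.cong) (auto simp: of_nat_diff less_imp_le subsetD)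
  then have imbF: "(\<Sum>e\<in>F. real (imb E e)) = (\<Sum>e\<in>F. ?D (h e)) - (\<Sum>e\<in>F. ?D (l e))"
    by (simp add: sum_subtractf)
  have "S = real k * real k - (\<Sum>u\<in>U. ?g u * ?g u)"
    unfolding S_def gk[symmetric] by (simp add: sum_subtractf right_diff_distrib sum_distrib_right)
  then have "(\<Sum>e\<in>F. real (imb E e)) \<le> real k * real k - real k + M"
    using \<psi>S \<psi>sum imbF by simp
  also have "real k * real k - real k = real (k * (k - 1))"
    using k1 by (simp add: of_nat_diff algebra_simps)
  finally have "real (\<Sum>e\<in>F. imb E e) \<le> real (k * (k - 1) + (\<Sum>e\<in>E - F. min k (imb E e)))"
    by (simp add: M_def)
  then show ?thesis unfolding erdos_gallai_ineq_def k_def of_nat_le_iff .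
qed

text \<open>
  Modulo 2, the imbalance of an edge is the sum of the degrees of its ends; over all edges these add
  up to the squares of the degrees, hence to the degrees, hence to twice the number of edges.
\<close>

lemma even_sum_imb:
  assumes G: "fin_simple_graph V E"
  shows "even (sum (imb E) E)"
proof -
  have "even (sum (imb E) E) \<longleftrightarrow> even (\<Sum>e\<in>E. \<Sum>v\<in>e. degree E v)"
  proof -
    have "even (imb E e + (\<Sum>v\<in>e. degree E v))" if "e \<in> E" for e
      using that by (rule edge_cases[OF G]) (auto simp: imb_insert even_nat_iff)
    then have "even (\<Sum>e\<in>E. imb E e + (\<Sum>v\<in>e. degree E v))" by (rule dvd_sum)
    then show ?thesis by (simp add: sum.distrib)
  qed
  also have "(\<Sum>e\<in>E. \<Sum>v\<in>e. degree E v) = (\<Sum>v\<in>V. \<Sum>w\<in>nbhd E v. degree E v)"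
    using sum_incidence[OF G, of "\<lambda>v e. degree E v"] by simp
  also have "\<dots> = (\<Sum>v\<in>V. degree E v * degree E v)"
    by (simp add: degree_eq_card_nbhd[OF G])
  also have "even \<dots> \<longleftrightarrow> even (\<Sum>v\<in>V. degree E v)"
  proof -
    have "even (\<Sum>v\<in>V. degree E v * degree E v + degree E v)" by (rule dvd_sum) simp
    then show ?thesis by (simp add: sum.distrib)
  qed
  also have "(\<Sum>v\<in>V. degree E v) = (\<Sum>v\<in>V. \<Sum>w\<in>nbhd E v. 1)"
    by (simp add: degree_eq_card_nbhd[OF G])
  also have "\<dots> = (\<Sum>e\<in>E. card e)"
    using sum_incidence[OF G, of "\<lambda>v e. 1::nat"] by simp
  also have "\<dots> = 2 * card E" using G by (simp add: fin_simple_graph_def)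
  finally show ?thesis by simp
qed

section \<open>The imbalance multiset is graphic\<close>

lemma graphic_degree_mset:
  assumes H: "fin_simple_graph I H"
  shows "graphic (degree_mset I H)"
proof -
  have finI: "finite I" using H by (simp add: fin_simple_graph_def)
  obtain f :: "'a \<Rightarrow> nat" and n where f: "f ` I = {i. i < n}" "inj_on f I"
    using finite_imp_inj_to_nat_seg[OF finI] by blast
  have sub: "\<And>e. e \<in> H \<Longrightarrow> e \<subseteq> I \<and> card e = 2" using H by (simp add: fin_simple_graph_def)
  have injH: "inj_on ((`) f) H"
  proof (rule inj_onI)
    fix a b assume "a \<in> H" "b \<in> H" "f ` a = f ` b"
    then show "a = b" using inj_on_image_eq_iff[OF f(2), of a b] sub by simp
  qed
  have "fin_simple_graph (f ` I) ((`) f ` H)"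
    unfolding fin_simple_graph_def
  proof (intro conjI ballI)
    fix e assume "e \<in> (`) f ` H"
    then obtain e' where e': "e' \<in> H" "e = f ` e'" by blast
    then show "e \<subseteq> f ` I" "card e = 2"
      using sub card_image[OF inj_on_subset[OF f(2), of e']] by auto
  qed (use finI in simp)
  moreover have "degree ((`) f ` H) (f i) = degree H i" if "i \<in> I" for i
  proof -
    have "{e \<in> (`) f ` H. f i \<in> e} = (`) f ` {e \<in> H. i \<in> e}"
    proof -
      have "f i \<in> f ` e \<longleftrightarrow> i \<in> e" if "e \<in> H" for e
        using inj_on_image_mem_iff[OF f(2) \<open>i \<in> I\<close>, of e] sub[OF that] by blast
      then show ?thesis by blast
    qed
    moreover have "inj_on ((`) f) {e \<in> H. i \<in> e}" by (rule inj_on_subset[OF injH]) simp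
    ultimately show ?thesis unfolding degree_def by (simp add: card_image)
  qed
  then have "degree_mset (f ` I) ((`) f ` H) = degree_mset I H"
    unfolding degree_mset_def image_mset_mset_set[OF f(2), symmetric] multiset.map_comp
    using finI by (intro image_mset_cong) simp
  ultimately show ?thesis unfolding graphic_def by blast
qed

theorem theorem1p1:
  fixes V :: "'a set" and E :: "'a set set"
  assumes "fin_simple_graph V E"
    and "\<forall>e\<in>E. imb E e > 0"
  shows "graphic (imbalance_mset E)"
proof -
  have finE: "finite E" using assms(1) by (rule fin_simple_graph_finite_edges)
  have "erdos_gallai_ineq E (imb E) F" if "F \<subseteq> E" for F
    using finE
  proof (rule erdos_gallai_ineq_if_large)
    show "erdos_gallai_ineq E (imb E) F" if "F \<subseteq> E" "\<forall>e\<in>F. card F \<le> imb E e" for F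
      using assms(1) _ that(1) by (rule imbalance_erdos_gallai_ineq) (use assms(2) that(2) in auto)
  qed (rule that)
  then obtain H where H: "fin_simple_graph E H" "\<And>e. e \<in> E \<Longrightarrow> degree H e = imb E e"
    using erdos_gallai[OF finE even_sum_imb[OF assms(1)]] by blast
  have "imbalance_mset E = degree_mset E H"
    unfolding imbalance_mset_def degree_mset_def using H(2) finE by (intro image_mset_cong) auto
  then show ?thesis using graphic_degree_mset[OF H(1)] by simp
qed

end
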